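(* There is no semi-regular map from $\mathbb{Z}^2$ to $\mathrm{Lamplighter}(\mathbb{Z})$. In particular, there is no regular map from $\mathbb{Z}^2$ to $\mathrm{Lamplighter}(\mathbb{Z})$.
   Context: $\mathbb{Z}^2$ is the square lattice graph. $\mathrm{Lamplighter}(\mathbb{Z})$ is a Cayley graph, with respect to a finite generating set, of the lamplighter group $(\mathbb{Z}/2\mathbb{Z})\wr\mathbb{Z}$. Graphs are regarded as metric spaces on their vertex sets, with the graph distance. Semi-regular maps: a map $f:X\to Y$ between bounded degree graphs is semi-regular if $f$ is Lipschitz and for every $r$ there is a $c(r)<\infty$ such that for every $y\in Y$ every connected component of (the subgraph of $X$ induced by) $f^{-1}(B(y,r))$ has diameter at most $c(r)$. Regular maps: for $\kappa<\infty$, a map $f:X\to Y$ of metric spaces is $\kappa$-regular if (1) $d_Y(f(x_0),f(x_1))\le \kappa(1+d_X(x_0,x_1))$ for every $x_0,x_1\in X$, and (2) for every open ball $B=B(y_0,1)$ of radius $1$ in $Y$, the inverse image $f^{-1}(B)$ can be covered by $\kappa$ open balls of radius $1$ in $X$. A map is regular if it is $\kappa$-regular for some finite $\kappa$. *)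

theory Defs
  imports "HOL-Analysis.Analysis" "HOL-Algebra.Product_Groups" "HOL-Algebra.Generated_Groups"
begin

section \<open>Graphs as metric spaces\<close>

text \<open>Undirected simple graphs, possibly infinite. An undirected edge is represented by both of
  its orientations.\<close>

record 'v graph =
  verts :: "'v set"
  edges :: "'v rel"

definition connected_graph :: "'v graph \<Rightarrow> bool" where
  "connected_graph G \<longleftrightarrow>
     edges G \<subseteq> verts G \<times> verts G \<and> sym (edges G) \<and> irrefl (edges G) \<and>
     (\<forall>x\<in>verts G. \<forall>y\<in>verts G. (x, y) \<in> (edges G)\<^sup>*)"

text \<open>The relational power \<open>edges G ^^ n\<close> relates the end points of walks of length \<open>n\<close>. The
  following two definitions are meaningful for connected graphs only; see
  \<open>Metric_space_graph_dist\<close> below.\<close>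

definition graph_dist :: "'v graph \<Rightarrow> 'v \<Rightarrow> 'v \<Rightarrow> real" where
  "graph_dist G x y = real (LEAST n. (x, y) \<in> edges G ^^ n)"

definition graph_metric :: "'v graph \<Rightarrow> 'v metric" where
  "graph_metric G = metric (verts G, graph_dist G)"

definition induced :: "'v graph \<Rightarrow> 'v set \<Rightarrow> 'v graph" where
  "induced G A = \<lparr>verts = verts G \<inter> A, edges = edges G \<inter> A \<times> A\<rparr>"

definition components_of_graph :: "'v graph \<Rightarrow> 'v set set" where
  "components_of_graph G =
     verts G // {(x, y). x \<in> verts G \<and> y \<in> verts G \<and> (x, y) \<in> (edges G)\<^sup>*}"

lemma relpow_sym:
  assumes "sym E" "(x, y) \<in> E ^^ n"
  shows "(y, x) \<in> E ^^ n"
  using assms(2)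
proof (induction n arbitrary: y)
  case (Suc n)
  then obtain z where "(x, z) \<in> E ^^ n" "(z, y) \<in> E" by auto
  with Suc.IH assms(1) show ?case by (meson relpow_Suc_I2 symD)
qed auto

lemma graph_dist_relpow:
  assumes "connected_graph G" "x \<in> verts G" "y \<in> verts G"
  obtains n where "graph_dist G x y = real n" "(x, y) \<in> edges G ^^ n"
proof -
  have "\<exists>n. (x, y) \<in> edges G ^^ n"
    using assms by (auto simp: connected_graph_def rtrancl_power)
  then show thesis
    using that by (metis LeastI_ex graph_dist_def)
qed

lemma graph_dist_le: "(x, y) \<in> edges G ^^ n \<Longrightarrow> graph_dist G x y \<le> real n"
  by (simp add: graph_dist_def Least_le)

lemma Metric_space_graph_dist:
  assumes G: "connected_graph G"
  shows "Metric_space (verts G) (graph_dist G)"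
proof
  show "0 \<le> graph_dist G x y" for x y by (simp add: graph_dist_def)
  have "(x, y) \<in> edges G ^^ n \<longleftrightarrow> (y, x) \<in> edges G ^^ n" for x y n
    using G relpow_sym by (metis connected_graph_def)
  then show "graph_dist G x y = graph_dist G y x" for x y by (simp add: graph_dist_def)
next
  fix x y assume xy: "x \<in> verts G" "y \<in> verts G"
  show "graph_dist G x y = 0 \<longleftrightarrow> x = y"
  proof
    assume "graph_dist G x y = 0"
    then show "x = y"
      using graph_dist_relpow[OF G xy] by (metis of_nat_eq_0_iff relpow_0_E)
  next
    assume "x = y"
    then have "graph_dist G x y \<le> real 0" by (intro graph_dist_le) simp
    then show "graph_dist G x y = 0" by (simp add: graph_dist_def)
  qed
next
  fix x y z assume xyz: "x \<in> verts G" "y \<in> verts G" "z \<in> verts G"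
  obtain m where m: "graph_dist G x y = real m" "(x, y) \<in> edges G ^^ m"
    using graph_dist_relpow[OF G] xyz by metis
  obtain n where n: "graph_dist G y z = real n" "(y, z) \<in> edges G ^^ n"
    using graph_dist_relpow[OF G] xyz by metis
  have "(x, z) \<in> edges G ^^ (m + n)" using m n by (auto simp: relpow_add)
  then show "graph_dist G x z \<le> graph_dist G x y + graph_dist G y z"
    using graph_dist_le m n by fastforce
qed

lemma
  assumes "connected_graph G"
  shows mspace_graph_metric: "mspace (graph_metric G) = verts G"
    and mdist_graph_metric: "mdist (graph_metric G) = graph_dist G"
  using Metric_space_graph_dist[OF assms]
  by (simp_all add: graph_metric_def Metric_space.mspace_metric Metric_space.mdist_metric)


section \<open>Semi-regular and regular maps\<close>

text \<open>The diameter of a component is taken with respect to the distance of the whole graph \<open>X\<close>.\<close>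

definition semi_regular_map :: "'v graph \<Rightarrow> 'w graph \<Rightarrow> ('v \<Rightarrow> 'w) \<Rightarrow> bool" where
  "semi_regular_map X Y f \<longleftrightarrow>
     Lipschitz_continuous_map (graph_metric X) (graph_metric Y) f \<and>
     (\<forall>r::real. \<exists>c::real. \<forall>y\<in>verts Y.
        \<forall>C\<in>components_of_graph (induced X (f -` mball_of (graph_metric Y) y r)).
          \<forall>x\<in>C. \<forall>x'\<in>C. mdist (graph_metric X) x x' \<le> c)"

definition k_regular_map :: "real \<Rightarrow> 'a metric \<Rightarrow> 'b metric \<Rightarrow> ('a \<Rightarrow> 'b) \<Rightarrow> bool" where
  "k_regular_map \<kappa> X Y f \<longleftrightarrow>
     f \<in> mspace X \<rightarrow> mspace Y \<and>
     (\<forall>x0\<in>mspace X. \<forall>x1\<in>mspace X. mdist Y (f x0) (f x1) \<le> \<kappa> * (1 + mdist X x0 x1)) \<and>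
     (\<forall>y0\<in>mspace Y. \<exists>P\<subseteq>mspace X. finite P \<and> real (card P) \<le> \<kappa> \<and>
        mspace X \<inter> f -` mball_of Y y0 1 \<subseteq> (\<Union>p\<in>P. mball_of X p 1))"

definition regular_map :: "'a metric \<Rightarrow> 'b metric \<Rightarrow> ('a \<Rightarrow> 'b) \<Rightarrow> bool" where
  "regular_map X Y f \<longleftrightarrow> (\<exists>\<kappa>. k_regular_map \<kappa> X Y f)"


section \<open>The square lattice\<close>

definition square_lattice :: "(int \<times> int) graph" where
  "square_lattice =
     \<lparr>verts = UNIV, edges = {((a, b), (c, d)). \<bar>a - c\<bar> + \<bar>b - d\<bar> = 1}\<rparr>"

lemma connected_square_lattice: "connected_graph square_lattice"
proof -
  let ?E = "edges square_lattice"
  have sym: "sym ?E" by (auto simp: square_lattice_def sym_def)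
  have step: "((a, b), (a + 1, b)) \<in> ?E" "((a, b), (a, b + 1)) \<in> ?E" for a b
    by (auto simp: square_lattice_def)
  have right: "((a, b), (a + int n, b)) \<in> ?E\<^sup>*" for a b n
  proof (induction n)
    case (Suc n)
    have "((a + int n, b), (a + int (Suc n), b)) \<in> ?E"
      using step(1)[of "a + int n" b] by (simp add: algebra_simps)
    with Suc show ?case by (rule rtrancl_into_rtrancl)
  qed simp
  have up: "((a, b), (a, b + int n)) \<in> ?E\<^sup>*" for a b n
  proof (induction n)
    case (Suc n)
    have "((a, b + int n), (a, b + int (Suc n))) \<in> ?E"
      using step(2)[of a "b + int n"] by (simp add: algebra_simps)
    with Suc show ?case by (rule rtrancl_into_rtrancl)
  qed simp
  have rs: "(y, x) \<in> ?E\<^sup>*" if "(x, y) \<in> ?E\<^sup>*" for x y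
    using that sym by (meson sym_rtrancl symD)
  have hor: "((a, b), (c, b)) \<in> ?E\<^sup>*" for a b c
  proof (cases "a \<le> c")
    case True then show ?thesis using right[of a b "nat (c - a)"] by simp
  next
    case False then show ?thesis using rs right[of c b "nat (a - c)"] by simp
  qed
  have ver: "((a, b), (a, d)) \<in> ?E\<^sup>*" for a b d
  proof (cases "b \<le> d")
    case True then show ?thesis using up[of a b "nat (d - b)"] by simp
  next
    case False then show ?thesis using rs up[of a d "nat (b - d)"] by simp
  qed
  have "(x, y) \<in> ?E\<^sup>*" for x y
    using hor ver by (cases x; cases y) (meson rtrancl_trans)
  then show ?thesis
    using sym by (auto simp: connected_graph_def square_lattice_def irrefl_def)
qed


section \<open>Cayley graphs\<close>

definition cayley_graph :: "('g, 'm) monoid_scheme \<Rightarrow> 'g set \<Rightarrow> 'g graph" where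
  "cayley_graph G S =
     \<lparr>verts = carrier G,
      edges = {(x, y). x \<in> carrier G \<and> y \<in> carrier G \<and> x \<noteq> y \<and>
                       (\<exists>s\<in>S. y = x \<otimes>\<^bsub>G\<^esub> s \<or> x = y \<otimes>\<^bsub>G\<^esub> s)}\<rparr>"

lemma (in group) connected_cayley_graph:
  assumes S: "S \<subseteq> carrier G" and gen: "generate G S = carrier G"
  shows "connected_graph (cayley_graph G S)"
proof -
  let ?E = "edges (cayley_graph G S)"
  have walk: "(x, x \<otimes> h) \<in> ?E\<^sup>*" if "h \<in> generate G S" "x \<in> carrier G" for h x
    using that
  proof (induction h arbitrary: x rule: generate.induct)
    case one
    then show ?case by simp
  next
    case (incl h)
    then have "x = x \<otimes> h \<or> (x, x \<otimes> h) \<in> ?E"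
      using S by (auto simp: cayley_graph_def)
    then show ?case by (metis r_into_rtrancl rtrancl.rtrancl_refl)
  next
    case (inv h)
    then have "h \<in> carrier G" using S by auto
    with inv have "x = (x \<otimes> inv h) \<otimes> h" by (simp add: m_assoc)
    with inv \<open>h \<in> carrier G\<close> have "x = x \<otimes> inv h \<or> (x, x \<otimes> inv h) \<in> ?E"
      by (auto simp: cayley_graph_def)
    then show ?case by (metis r_into_rtrancl rtrancl.rtrancl_refl)
  next
    case (eng h1 h2)
    then have h: "h1 \<in> carrier G" "h2 \<in> carrier G" using gen by auto
    have "(x, x \<otimes> h1) \<in> ?E\<^sup>*" "(x \<otimes> h1, x \<otimes> h1 \<otimes> h2) \<in> ?E\<^sup>*"
      using eng h by auto
    then show ?case using eng h by (metis m_assoc rtrancl_trans)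
  qed
  have "(x, y) \<in> ?E\<^sup>*" if "x \<in> carrier G" "y \<in> carrier G" for x y
  proof -
    have "x \<otimes> (inv x \<otimes> y) = y" using that by (simp add: m_assoc[symmetric])
    then show ?thesis using walk[of "inv x \<otimes> y" x] that gen by simp
  qed
  then show ?thesis
    by (auto simp: connected_graph_def cayley_graph_def sym_def irrefl_def)
qed


section \<open>The lamplighter group\<close>

text \<open>The restricted wreath product of \<open>G\<close> and \<open>H\<close>: the semidirect product of the direct sum of
  copies of \<open>G\<close> indexed by \<open>H\<close> with \<open>H\<close>, acting by translation of the coordinates.\<close>

definition wreath_product ::
  "('a, 'm) monoid_scheme \<Rightarrow> ('b, 'n) monoid_scheme \<Rightarrow> (('b \<Rightarrow> 'a) \<times> 'b) monoid" where
  "wreath_product G H =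
     (let N = sum_group (carrier H) (\<lambda>_. G) in
      \<lparr>carrier = carrier N \<times> carrier H,
       monoid.mult = (\<lambda>(f, h) (g, k).
         (f \<otimes>\<^bsub>N\<^esub> (\<lambda>x\<in>carrier H. g (inv\<^bsub>H\<^esub> h \<otimes>\<^bsub>H\<^esub> x)), h \<otimes>\<^bsub>H\<^esub> k)),
       one = (\<one>\<^bsub>N\<^esub>, \<one>\<^bsub>H\<^esub>)\<rparr>)"

definition lamplighter_group :: "((int \<Rightarrow> int) \<times> int) monoid" where
  "lamplighter_group = wreath_product (integer_mod_group 2) integer_group"

lemma carrier_lamplighter:
  "carrier lamplighter_group = {(f, m). (\<forall>i. f i \<in> {0..<2}) \<and> finite {i. f i \<noteq> 0}}"
  by (auto simp: lamplighter_group_def wreath_product_def carrier_sum_group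
      carrier_integer_mod_group PiE_iff)

lemma mult_lamplighter:
  "(f, m) \<otimes>\<^bsub>lamplighter_group\<^esub> (g, n) = (\<lambda>i. (f i + g (i - m)) mod 2, m + n)"
  by (simp add: lamplighter_group_def wreath_product_def restrict_def)

lemma one_lamplighter: "\<one>\<^bsub>lamplighter_group\<^esub> = (\<lambda>i. 0, 0)"
  by (simp add: lamplighter_group_def wreath_product_def restrict_def)

lemma finite_shift:
  fixes m :: int
  assumes "finite {i. g i \<noteq> 0}"
  shows "finite {i. g (i - m) \<noteq> 0}"
proof -
  have "inj (\<lambda>i. i - m)" by (simp add: inj_on_def)
  from finite_vimageI[OF assms this] show ?thesis by (simp add: vimage_def)
qed

lemma group_lamplighter: "group lamplighter_group"
proof (rule groupI)
  fix x y assume "x \<in> carrier lamplighter_group" "y \<in> carrier lamplighter_group"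
  moreover obtain f m g n where "x = (f, m)" "y = (g, n)" by (meson surj_pair)
  ultimately have fin: "finite {i. f i \<noteq> 0}" "finite {i. g i \<noteq> 0}"
    and xy: "x = (f, m)" "y = (g, n)"
    by (auto simp: carrier_lamplighter)
  have "{i. (f i + g (i - m)) mod 2 \<noteq> 0} \<subseteq> {i. f i \<noteq> 0} \<union> {i. g (i - m) \<noteq> 0}" by auto
  then have "finite {i. (f i + g (i - m)) mod 2 \<noteq> 0}"
    by (rule finite_subset) (use fin finite_shift[of g m] in simp)
  then show "x \<otimes>\<^bsub>lamplighter_group\<^esub> y \<in> carrier lamplighter_group"
    by (auto simp: xy carrier_lamplighter mult_lamplighter)
next
  show "\<one>\<^bsub>lamplighter_group\<^esub> \<in> carrier lamplighter_group"
    by (simp add: carrier_lamplighter one_lamplighter)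
next
  fix x y z
  show "x \<otimes>\<^bsub>lamplighter_group\<^esub> y \<otimes>\<^bsub>lamplighter_group\<^esub> z =
        x \<otimes>\<^bsub>lamplighter_group\<^esub> (y \<otimes>\<^bsub>lamplighter_group\<^esub> z)"
  proof -
    obtain f m g n h k where "x = (f, m)" "y = (g, n)" "z = (h, k)"
      by (cases x; cases y; cases z) blast
    then show ?thesis
      by (simp add: mult_lamplighter fun_eq_iff mod_simps diff_diff_eq add.assoc)
  qed
next
  fix x assume "x \<in> carrier lamplighter_group"
  then show "\<one>\<^bsub>lamplighter_group\<^esub> \<otimes>\<^bsub>lamplighter_group\<^esub> x = x"
    by (auto simp: mult_lamplighter one_lamplighter carrier_lamplighter)
next
  fix x assume x: "x \<in> carrier lamplighter_group"
  then obtain f m where f: "x = (f, m)" "\<forall>i. f i \<in> {0..<2}" "finite {i. f i \<noteq> 0}"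
    by (auto simp: carrier_lamplighter)
  let ?y = "(\<lambda>i. f (i + m), - m)"
  have "finite {i. f (i + m) \<noteq> 0}" using finite_shift[OF f(3), of "- m"] by simp
  then have "?y \<in> carrier lamplighter_group"
    using f by (auto simp: carrier_lamplighter)
  moreover have "?y \<otimes>\<^bsub>lamplighter_group\<^esub> x = \<one>\<^bsub>lamplighter_group\<^esub>"
    by (simp add: f(1) mult_lamplighter one_lamplighter)
  ultimately show "\<exists>y\<in>carrier lamplighter_group. y \<otimes>\<^bsub>lamplighter_group\<^esub> x = \<one>\<^bsub>lamplighter_group\<^esub>"
    by blast
qed

end

(*
  The lamplighter group has asymptotic dimension one while the square lattice has dimension two,
  and semi-regular maps cannot lower the dimension. Colour a lattice point z by the parity of the
  block of length M containing the lamplighter's position in f z. If M exceeds the displacement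
  that f allows between neighbours, then along a monochromatic cluster the lamplighter stays in one
  block and only lamps near that block change, so the image has bounded diameter and, by
  semi-regularity, so does the cluster. But no two-colouring of the lattice has clusters of bounded
  diameter, by Kuhn's combinatorial form of Brouwer's fixed point theorem. A regular map into a
  graph whose balls of given radius have boundedly many points is semi-regular, because a connected
  set is no wider than the number of edges that it spans.
*)

theory Submission
  imports Defs
begin

section \<open>Two-colourings of the square lattice\<close>

definition king_adj :: "int \<times> int \<Rightarrow> int \<times> int \<Rightarrow> bool" where
  "king_adj z w \<longleftrightarrow> \<bar>fst z - fst w\<bar> \<le> 1 \<and> \<bar>snd z - snd w\<bar> \<le> 1"

text \<open>Kuhn's lemma is applied on \<open>{0..p}\<^sup>2\<close> with labels in \<open>{0, 1}\<^sup>2\<close>. A point of the first colour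
  class (\<open>diag\<close>) is labelled 00 or 11, a point of the other one 01 or 10, according to its
  representative. A small square meets at most one cluster of either colour, so it shows at most
  two labels, which are never complementary. The boundary conditions force the labels at the four
  corners, where the colouring is therefore overridden.\<close>

lemma two_colouring_unbounded_clusters:
  fixes col :: "int \<times> int \<Rightarrow> bool" and rep :: "int \<times> int \<Rightarrow> int \<times> int" and c :: int
  assumes dist: "\<And>z. \<bar>fst (rep z) - fst z\<bar> \<le> c \<and> \<bar>snd (rep z) - snd z\<bar> \<le> c"
    and rep: "\<And>z w. king_adj z w \<Longrightarrow> col z = col w \<Longrightarrow> rep z = rep w"
  shows False
proof -
  have c: "c \<ge> 0" using dist[of "(0, 0)"] by linarith
  \<comment> \<open>A point at most one king move away from a corner region has its representative
    within \<open>3 * c + 1\<close> of that corner in each coordinate. Any \<open>p\<close> above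
    \<open>6 * c + 2\<close> therefore separates opposite corners; the chosen value leaves
    slack.\<close>
  define p where "p = 12 * c + 20"
  \<comment> \<open>The radius \<open>2 * c\<close> absorbs the drift of both coordinates of
    \<open>rep\<close>, up to \<open>c\<close> each: on a side of the big square, away from these
    corners, the drift cannot reverse the inequality that decides \<open>v\<close>.\<close>
  define near :: "int \<times> int \<Rightarrow> int \<times> int \<Rightarrow> bool"
    where "near k z \<longleftrightarrow> \<bar>fst z - fst k\<bar> \<le> 2 * c \<and> \<bar>snd z - snd k\<bar> \<le> 2 * c" for k z
  define diag where "diag z \<longleftrightarrow> near (0, 0) z \<or> near (p, p) z \<or>
    (col z \<and> \<not> near (p, 0) z \<and> \<not> near (0, p) z)" for z
  \<comment> \<open>\<open>v\<close> becomes the first bit of the label. It tells 11 from 00 by the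
    side of the antidiagonal on which the representative lies, and 10 from 01 by the side of the
    main diagonal.\<close>
  define v where "v z \<longleftrightarrow>
    (if diag z then fst (rep z) + snd (rep z) \<ge> p else fst (rep z) \<ge> snd (rep z))" for z
  \<comment> \<open>Adjacent points of one class but of different colours occur only at an
    overridden corner, where all representatives lie on the same side of the line in
    question.\<close>
  have v_eq: "v z = v w" if "king_adj z w" "diag z = diag w" for z w
  proof (cases "col z = col w")
    case True
    with that rep show ?thesis by (simp add: v_def)
  next
    case False
    have k: "\<bar>fst z - fst w\<bar> \<le> 1" "\<bar>snd z - snd w\<bar> \<le> 1"
      using that(1) by (auto simp: king_adj_def)
    note bounds = k[unfolded abs_le_iff] c dist[of z, unfolded abs_le_iff] dist[of w, unfolded abs_le_iff]
    show ?thesis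
    proof (cases "diag z")
      case True
      with that(2) False consider "near (0, 0) z \<or> near (0, 0) w" | "near (p, p) z \<or> near (p, p) w"
        unfolding diag_def by blast
      then show ?thesis
      proof cases
        case 1
        then have "fst (rep z) + snd (rep z) < p" "fst (rep w) + snd (rep w) < p"
          using bounds unfolding near_def p_def fst_conv snd_conv abs_le_iff by linarith+
        then show ?thesis using True that(2) by (simp add: v_def)
      next
        case 2
        then have "fst (rep z) + snd (rep z) \<ge> p" "fst (rep w) + snd (rep w) \<ge> p"
          using bounds unfolding near_def p_def fst_conv snd_conv abs_le_iff by linarith+
        then show ?thesis using True that(2) by (simp add: v_def)
      qed
    next
      case nd: False
      with that(2) False consider "near (p, 0) z \<or> near (p, 0) w" | "near (0, p) z \<or> near (0, p) w"
        unfolding diag_def by blast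
      then show ?thesis
      proof cases
        case 1
        then have "fst (rep z) \<ge> snd (rep z)" "fst (rep w) \<ge> snd (rep w)"
          using bounds unfolding near_def p_def fst_conv snd_conv abs_le_iff by linarith+
        then show ?thesis using nd that(2) by (simp add: v_def)
      next
        case 2
        then have "fst (rep z) < snd (rep z)" "fst (rep w) < snd (rep w)"
          using bounds unfolding near_def p_def fst_conv snd_conv abs_le_iff by linarith+
        then show ?thesis using nd that(2) by (simp add: v_def)
      qed
    qed
  qed
  define pt where "pt x = (int (x 0), int (x 1))" for x :: "nat \<Rightarrow> nat"
  define label :: "(nat \<Rightarrow> nat) \<Rightarrow> nat \<Rightarrow> nat"
    where "label x i = (if (if i = 0 \<or> diag (pt x) then v (pt x) else \<not> v (pt x)) then 1 else 0)"
    for x i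
  have "0 < nat p" using c by (simp add: p_def)
  then obtain q where q: "\<forall>i<2. \<exists>r s. (\<forall>j<2. q j \<le> r j \<and> r j \<le> q j + 1) \<and>
      (\<forall>j<2. q j \<le> s j \<and> s j \<le> q j + 1) \<and> label r i \<noteq> label s i"
  proof (rule kuhn_lemma[where label = label and n = 2])
    show "\<forall>x. (\<forall>i<2. x i \<le> nat p) \<longrightarrow> (\<forall>i<2. label x i = 0 \<or> label x i = 1)"
      by (simp add: label_def)
    show "\<forall>x. (\<forall>i<2. x i \<le> nat p) \<longrightarrow> (\<forall>i<2. x i = 0 \<longrightarrow> label x i = 0)"
    proof (intro allI impI)
      fix x :: "nat \<Rightarrow> nat" and i :: nat
      assume x: "\<forall>i<2. x i \<le> nat p" and i: "i < 2" "x i = 0"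
      have b: "0 \<le> fst (pt x)" "fst (pt x) \<le> p" "0 \<le> snd (pt x)" "snd (pt x) \<le> p"
        using x[rule_format, of 0] x[rule_format, of 1] c by (simp_all add: pt_def p_def)
      from i consider "i = 0" "fst (pt x) = 0" | "i = 1" "snd (pt x) = 0"
        by (auto simp: less_2_cases_iff pt_def)
      then show "label x i = 0"
      proof cases
        case 1
        \<comment> \<open>The override keeps \<open>diag\<close> points away from the end
          \<open>(0, p)\<close> of this side and all others away from the end \<open>(0, 0)\<close>.
          The other three sides are alike.\<close>
        have "diag (pt x) \<Longrightarrow> snd (pt x) < p - 2 * c" "\<not> diag (pt x) \<Longrightarrow> 2 * c < snd (pt x)"
          using 1 b c by (auto simp: diag_def near_def p_def abs_le_iff)
        then have "\<not> v (pt x)"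
          using 1 b c dist[of "pt x", unfolded abs_le_iff] unfolding v_def by (cases "diag (pt x)"; simp)
        with 1 show ?thesis by (simp add: label_def)
      next
        case 2
        have "diag (pt x) \<Longrightarrow> fst (pt x) < p - 2 * c" "\<not> diag (pt x) \<Longrightarrow> 2 * c < fst (pt x)"
          using 2 b c by (auto simp: diag_def near_def p_def abs_le_iff)
        then have "v (pt x) = (\<not> diag (pt x))"
          using 2 b c dist[of "pt x", unfolded abs_le_iff] unfolding v_def by (cases "diag (pt x)"; simp)
        with 2 show ?thesis by (simp add: label_def)
      qed
    qed
    show "\<forall>x. (\<forall>i<2. x i \<le> nat p) \<longrightarrow> (\<forall>i<2. x i = nat p \<longrightarrow> label x i = 1)"
    proof (intro allI impI)
      fix x :: "nat \<Rightarrow> nat" and i :: nat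
      assume x: "\<forall>i<2. x i \<le> nat p" and i: "i < 2" "x i = nat p"
      have b: "0 \<le> fst (pt x)" "fst (pt x) \<le> p" "0 \<le> snd (pt x)" "snd (pt x) \<le> p"
        using x[rule_format, of 0] x[rule_format, of 1] c by (simp_all add: pt_def p_def)
      from i c consider "i = 0" "fst (pt x) = p" | "i = 1" "snd (pt x) = p"
        by (auto simp: less_2_cases_iff pt_def p_def)
      then show "label x i = 1"
      proof cases
        case 1
        have "diag (pt x) \<Longrightarrow> 2 * c < snd (pt x)" "\<not> diag (pt x) \<Longrightarrow> snd (pt x) < p - 2 * c"
          using 1 b c by (auto simp: diag_def near_def p_def abs_le_iff)
        then have "v (pt x)"
          using 1 b c dist[of "pt x", unfolded abs_le_iff] unfolding v_def by (cases "diag (pt x)"; simp)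
        with 1 show ?thesis by (simp add: label_def)
      next
        case 2
        have "diag (pt x) \<Longrightarrow> 2 * c < fst (pt x)" "\<not> diag (pt x) \<Longrightarrow> fst (pt x) < p - 2 * c"
          using 2 b c by (auto simp: diag_def near_def p_def abs_le_iff)
        then have "v (pt x) = diag (pt x)"
          using 2 b c dist[of "pt x", unfolded abs_le_iff] unfolding v_def by (cases "diag (pt x)"; simp)
        with 2 show ?thesis by (simp add: label_def)
      qed
    qed
  qed
  define sq where "sq x \<longleftrightarrow> (\<forall>j<2. q j \<le> x j \<and> x j \<le> q j + 1)" for x :: "nat \<Rightarrow> nat"
  have adj: "king_adj (pt x) (pt y)" if "sq x" "sq y" for x y
    using that[unfolded sq_def, THEN spec, of 0] that[unfolded sq_def, THEN spec, of 1]
    by (auto simp: king_adj_def pt_def)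
  obtain r s where rs: "sq r" "sq s" "label r 0 \<noteq> label s 0"
    using q unfolding sq_def by (metis zero_less_numeral)
  obtain r' s' where rs': "sq r'" "sq s'" "label r' 1 \<noteq> label s' 1"
    using q unfolding sq_def by (metis one_less_numeral_iff semiring_norm(76))
  have "v (pt r) \<noteq> v (pt s)"
    using rs by (auto simp: label_def split: if_splits)
  moreover have "(v (pt r') = diag (pt r')) \<noteq> (v (pt s') = diag (pt s'))"
    using rs' by (auto simp: label_def split: if_splits)
  \<comment> \<open>By \<open>v_eq\<close>, \<open>r\<close> and \<open>s\<close> differ in
    \<open>diag\<close>, so both classes occur in the small square, with opposite values of
    \<open>v\<close>. As \<open>v\<close> is constant on each class there, so is the truth value of
    \<open>v = diag\<close> on the square, against \<open>r'\<close> and \<open>s'\<close>.\<close>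
  ultimately show False
    using v_eq adj rs(1,2) rs'(1,2) by metis
qed


section \<open>Semi-regular maps on the square lattice\<close>

lemma verts_square_lattice [simp]: "verts square_lattice = UNIV"
  by (simp add: square_lattice_def)

lemma square_lattice_relpow_bound:
  assumes "(z, w) \<in> edges square_lattice ^^ n"
  shows "\<bar>fst w - fst z\<bar> + \<bar>snd w - snd z\<bar> \<le> int n"
  using assms
proof (induction n arbitrary: w)
  case (Suc n)
  then obtain y where y: "(z, y) \<in> edges square_lattice ^^ n" "(y, w) \<in> edges square_lattice"
    by auto
  have "\<bar>fst y - fst w\<bar> + \<bar>snd y - snd w\<bar> = 1"
    using y(2) by (auto simp: square_lattice_def)
  with Suc.IH[OF y(1)] show ?case by simp
qed auto

lemma square_lattice_coord_le_dist:
  "real_of_int (\<bar>fst w - fst z\<bar> + \<bar>snd w - snd z\<bar>) \<le> graph_dist square_lattice z w"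
proof -
  obtain n where "graph_dist square_lattice z w = real n" "(z, w) \<in> edges square_lattice ^^ n"
    using graph_dist_relpow[OF connected_square_lattice] by (metis UNIV_I verts_square_lattice)
  then show ?thesis
    using square_lattice_relpow_bound by (metis of_int_le_iff of_int_of_nat_eq)
qed

text \<open>Kuhn's lemma compares any two corners of a unit square, so diagonal moves have to be
  replaced by two lattice edges through a third corner.\<close>

lemma king_adj_midpoint:
  assumes "king_adj z w"
  obtains m where "z = m \<or> (z, m) \<in> edges square_lattice" "m = w \<or> (m, w) \<in> edges square_lattice"
proof (rule that[of "(fst z, snd w)"])
  show "z = (fst z, snd w) \<or> (z, (fst z, snd w)) \<in> edges square_lattice"
    "(fst z, snd w) = w \<or> ((fst z, snd w), w) \<in> edges square_lattice"
    using assms by (cases z; cases w; auto simp: king_adj_def square_lattice_def)+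
qed

lemma graph_dist_edge_le:
  assumes "x = y \<or> (x, y) \<in> edges G"
  shows "graph_dist G x y \<le> 1"
proof -
  have "(x, y) \<in> edges G ^^ 0 \<or> (x, y) \<in> edges G ^^ 1" using assms by auto
  then show ?thesis using graph_dist_le[of x y 0 G] graph_dist_le[of x y 1 G] by auto
qed

text \<open>King moves instead of lattice edges, to match the adjacency in
  \<open>two_colouring_unbounded_clusters\<close>.\<close>

definition clusters :: "(int \<times> int \<Rightarrow> bool) \<Rightarrow> (int \<times> int) rel" where
  "clusters col = {(z, w). king_adj z w \<and> col z = col w}\<^sup>*"

lemma semi_regular_map_Lipschitz:
  assumes X: "connected_graph X" and Y: "connected_graph Y" and f: "semi_regular_map X Y f"
  obtains L where "L \<ge> 0" "f \<in> verts X \<rightarrow> verts Y"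
    "\<And>x y. x \<in> verts X \<Longrightarrow> y \<in> verts X \<Longrightarrow> graph_dist Y (f x) (f y) \<le> L * graph_dist X x y"
proof -
  obtain B where B: "\<forall>x\<in>verts X. \<forall>y\<in>verts X.
      graph_dist Y (f x) (f y) \<le> B * graph_dist X x y" and im: "f \<in> verts X \<rightarrow> verts Y"
    using f unfolding semi_regular_map_def Lipschitz_continuous_map_def
      mspace_graph_metric[OF X] mspace_graph_metric[OF Y]
      mdist_graph_metric[OF X] mdist_graph_metric[OF Y] by blast
  have "B * graph_dist X x y \<le> \<bar>B\<bar> * graph_dist X x y" for x y
    by (intro mult_right_mono) (auto simp: graph_dist_def)
  then have "graph_dist Y (f x) (f y) \<le> \<bar>B\<bar> * graph_dist X x y"
    if "x \<in> verts X" "y \<in> verts X" for x y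
    using B that order_trans by blast
  with im show thesis by (intro that[of "\<bar>B\<bar>"]) simp_all
qed

text \<open>A cluster, together with the midpoints of its king moves, is a connected part of the
  preimage of one ball. Semi-regularity bounds its diameter uniformly, which no two-colouring
  allows.\<close>

lemma no_semi_regular_map_square_lattice:
  assumes Y: "connected_graph Y" and f: "semi_regular_map square_lattice Y f"
    and R: "\<And>z w. (z, w) \<in> clusters col \<Longrightarrow> graph_dist Y (f z) (f w) \<le> R"
  shows False
proof -
  let ?X = "square_lattice"
  note X = connected_square_lattice
  interpret Y: Metric_space "verts Y" "graph_dist Y" by (rule Metric_space_graph_dist[OF Y])
  obtain L where L: "L \<ge> 0" "f \<in> UNIV \<rightarrow> verts Y"
    "\<And>x y. graph_dist Y (f x) (f y) \<le> L * graph_dist ?X x y"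
    using semi_regular_map_Lipschitz[OF X Y f] by auto
  have fY: "f z \<in> verts Y" for z using L(2) by auto
  \<comment> \<open>The summand \<open>L\<close> makes room for the images of midpoints, which may
    leave the cluster; the 1 is there because balls are open.\<close>
  define r where "r = R + L + 1"
  define D where "D z = f -` mball_of (graph_metric Y) (f z) r" for z
  obtain c where c: "\<forall>y\<in>verts Y. \<forall>C\<in>components_of_graph (induced ?X (f -` mball_of (graph_metric Y) y r)).
      \<forall>x\<in>C. \<forall>x'\<in>C. mdist (graph_metric ?X) x x' \<le> c"
    using f unfolding semi_regular_map_def by blast
  have D_iff: "w \<in> D z \<longleftrightarrow> graph_dist Y (f z) (f w) < r" for z w
    using fY by (simp add: D_def mspace_graph_metric[OF Y] mdist_graph_metric[OF Y])
  have conn: "(z, w) \<in> (edges (induced ?X (D z)))\<^sup>*" if "(z, w) \<in> clusters col" for z w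
    using that unfolding clusters_def
  proof (induction rule: rtrancl_induct)
    case (step y w)
    have zy: "(z, y) \<in> clusters col" using step(1) by (simp add: clusters_def)
    have zw: "(z, w) \<in> clusters col" using step(1,2) unfolding clusters_def by (rule rtrancl_into_rtrancl)
    obtain m where m: "y = m \<or> (y, m) \<in> edges ?X" "m = w \<or> (m, w) \<in> edges ?X"
      using step(2) king_adj_midpoint by blast
    have "graph_dist Y (f y) (f m) \<le> L"
      using L(3)[of y m] mult_left_mono[OF graph_dist_edge_le[OF m(1)] L(1)] by simp
    then have "graph_dist Y (f z) (f m) \<le> R + L"
      using R[OF zy] Y.triangle[OF fY[of z] fY[of y] fY[of m]] by linarith
    then have "m \<in> D z" "y \<in> D z" "w \<in> D z"
      using R[OF zy] R[OF zw] L(1) by (auto simp: D_iff r_def)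
    then have "(y, m) \<in> (edges (induced ?X (D z)))\<^sup>*" "(m, w) \<in> (edges (induced ?X (D z)))\<^sup>*"
      using m by (auto simp: induced_def)
    with step.IH show ?case by (meson rtrancl_trans)
  qed simp
  have bound: "\<bar>fst w - fst z\<bar> \<le> \<lfloor>c\<rfloor> \<and> \<bar>snd w - snd z\<bar> \<le> \<lfloor>c\<rfloor>" if "(z, w) \<in> clusters col" for z w
  proof -
    let ?E = "{(x, y). x \<in> verts (induced ?X (D z)) \<and> y \<in> verts (induced ?X (D z)) \<and>
        (x, y) \<in> (edges (induced ?X (D z)))\<^sup>*}"
    have "(z, z) \<in> clusters col" by (simp add: clusters_def)
    then have V: "z \<in> D z" "w \<in> D z"
      using R[OF that] R[of z z] L(1) by (auto simp: D_iff r_def)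
    have "?E `` {z} \<in> components_of_graph (induced ?X (D z))"
      unfolding components_of_graph_def using V by (intro quotientI) (simp add: induced_def)
    moreover have "z \<in> ?E `` {z}" "w \<in> ?E `` {z}"
      using V conn[OF that] by (auto simp: induced_def)
    ultimately have "mdist (graph_metric ?X) z w \<le> c"
      by (rule c[rule_format, OF fY, of _ z, folded D_def])
    then have "real_of_int (\<bar>fst w - fst z\<bar> + \<bar>snd w - snd z\<bar>) \<le> c"
      using square_lattice_coord_le_dist[of w z] by (simp add: mdist_graph_metric[OF X])
    then have "\<bar>fst w - fst z\<bar> + \<bar>snd w - snd z\<bar> \<le> \<lfloor>c\<rfloor>" by (simp add: le_floor_iff)
    then show ?thesis by linarith
  qed
  \<comment> \<open>The choice is made from the cluster as a set, so all points of a cluster get the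
    same representative.\<close>
  define rep where "rep z = (SOME w. w \<in> clusters col `` {z})" for z
  have "sym (clusters col)"
    unfolding clusters_def by (rule sym_rtrancl) (auto simp: sym_def king_adj_def)
  moreover have "trans (clusters col)" unfolding clusters_def by (rule trans_rtrancl)
  ultimately have img: "clusters col `` {z} = clusters col `` {w}" if "(z, w) \<in> clusters col" for z w
    using that by (auto dest: symD transD)
  have rep_in: "(z, rep z) \<in> clusters col" for z
  proof -
    have "z \<in> clusters col `` {z}" by (simp add: clusters_def)
    then have "rep z \<in> clusters col `` {z}" unfolding rep_def by (rule someI)
    then show ?thesis by simp
  qed
  show False
  proof (rule two_colouring_unbounded_clusters)
    show "\<bar>fst (rep z) - fst z\<bar> \<le> \<lfloor>c\<rfloor> \<and> \<bar>snd (rep z) - snd z\<bar> \<le> \<lfloor>c\<rfloor>" for z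
      using bound[OF rep_in] .
    show "rep z = rep w" if "king_adj z w" "col z = col w" for z w
    proof -
      have "(z, w) \<in> clusters col" using that by (auto simp: clusters_def)
      then show ?thesis unfolding rep_def by (simp add: img)
    qed
  qed
qed


section \<open>Regular maps into graphs of bounded growth\<close>

lemma relpow_mono:
  fixes R S :: "'a rel"
  assumes "R \<subseteq> S"
  shows "R ^^ n \<subseteq> S ^^ n"
  by (induction n) (simp_all add: relcomp_mono assms)

text \<open>Distances are integers. So distinct points have distance at least 1, which absorbs the
  additive constant into a Lipschitz constant, and open unit balls are single points, so that
  condition (2) bounds the size of fibres. Preimages of balls then have boundedly many
  points.\<close>

lemma regular_map_imp_semi_regular_map:
  assumes X: "connected_graph X" and Y: "connected_graph Y"
    and growth: "\<And>r. \<exists>N. \<forall>y\<in>verts Y. finite (mball_of (graph_metric Y) y r) \<and>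
      card (mball_of (graph_metric Y) y r) \<le> N"
    and f: "regular_map (graph_metric X) (graph_metric Y) f"
  shows "semi_regular_map X Y f"
proof -
  interpret X: Metric_space "verts X" "graph_dist X" by (rule Metric_space_graph_dist[OF X])
  interpret Y: Metric_space "verts Y" "graph_dist Y" by (rule Metric_space_graph_dist[OF Y])
  note [simp] = mspace_graph_metric[OF X] mspace_graph_metric[OF Y]
    mdist_graph_metric[OF X] mdist_graph_metric[OF Y]
  obtain \<kappa> where "k_regular_map \<kappa> (graph_metric X) (graph_metric Y) f"
    using f unfolding regular_map_def by blast
  then have \<kappa>: "f \<in> verts X \<rightarrow> verts Y"
    "\<And>x0 x1. x0 \<in> verts X \<Longrightarrow> x1 \<in> verts X \<Longrightarrow>
      graph_dist Y (f x0) (f x1) \<le> \<kappa> * (1 + graph_dist X x0 x1)"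
    "\<And>y0. y0 \<in> verts Y \<Longrightarrow> \<exists>P\<subseteq>verts X. finite P \<and> real (card P) \<le> \<kappa> \<and>
      verts X \<inter> f -` mball_of (graph_metric Y) y0 1 \<subseteq> (\<Union>p\<in>P. mball_of (graph_metric X) p 1)"
    unfolding k_regular_map_def by (simp_all add: Pi_iff)
  have Lip: "graph_dist Y (f x) (f x') \<le> 2 * \<bar>\<kappa>\<bar> * graph_dist X x x'"
    if x: "x \<in> verts X" "x' \<in> verts X" for x x'
  proof (cases "x = x'")
    case True
    have "f x' \<in> verts Y" using \<kappa>(1) x by auto
    with True show ?thesis by simp
  next
    case False
    then have "graph_dist X x x' \<noteq> 0" using x by simp
    then have d: "graph_dist X x x' \<ge> 1" by (simp add: graph_dist_def)
    have "\<kappa> * (1 + graph_dist X x x') \<le> \<bar>\<kappa>\<bar> * (1 + graph_dist X x x')"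
      using d by (intro mult_right_mono) auto
    also have "\<dots> \<le> \<bar>\<kappa>\<bar> * (2 * graph_dist X x x')"
      using d by (intro mult_left_mono) auto
    finally show ?thesis using \<kappa>(2)[OF x] by simp
  qed
  define k where "k = nat \<lfloor>\<kappa>\<rfloor>"
  have fibre: "finite (verts X \<inter> f -` {y}) \<and> card (verts X \<inter> f -` {y}) \<le> k" if y: "y \<in> verts Y" for y
  proof -
    obtain P where P: "P \<subseteq> verts X" "finite P" "real (card P) \<le> \<kappa>"
      "verts X \<inter> f -` mball_of (graph_metric Y) y 1 \<subseteq> (\<Union>p\<in>P. mball_of (graph_metric X) p 1)"
      using \<kappa>(3)[OF y] by blast
    have "verts X \<inter> f -` {y} \<subseteq> P"
    proof
      fix x assume x: "x \<in> verts X \<inter> f -` {y}"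
      with y have "x \<in> verts X \<inter> f -` mball_of (graph_metric Y) y 1" by simp
      then obtain p where p: "p \<in> P" "p \<in> verts X" "graph_dist X p x < 1" using P(4) by auto
      then have "graph_dist X p x = 0" by (simp add: graph_dist_def)
      with p x show "x \<in> P" by simp
    qed
    moreover have "card P \<le> k" using P(3) by (simp add: k_def le_nat_iff le_floor_iff)
    ultimately show ?thesis using P(2) by (meson card_mono finite_subset order_trans)
  qed
  have "\<exists>c. \<forall>y\<in>verts Y. \<forall>C\<in>components_of_graph (induced X (f -` mball_of (graph_metric Y) y r)).
      \<forall>x\<in>C. \<forall>x'\<in>C. mdist (graph_metric X) x x' \<le> c" for r
  proof -
    obtain N where N: "\<And>y. y \<in> verts Y \<Longrightarrow> finite (mball_of (graph_metric Y) y r)"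
      "\<And>y. y \<in> verts Y \<Longrightarrow> card (mball_of (graph_metric Y) y r) \<le> N"
      using growth[of r] by auto
    have "graph_dist X x x' \<le> real (N * k * (N * k))"
      if y: "y \<in> verts Y" and C: "C \<in> components_of_graph (induced X (f -` mball_of (graph_metric Y) y r))"
        and x: "x \<in> C" "x' \<in> C" for y C x x'
    proof -
      define B where "B = mball_of (graph_metric Y) y r"
      define A where "A = verts X \<inter> f -` B"
      define E where "E = edges (induced X (f -` B))"
      have A: "A = (\<Union>b\<in>B. verts X \<inter> f -` {b})" by (auto simp: A_def)
      have B: "B \<subseteq> verts Y" "finite B" "card B \<le> N" using N[OF y] by (auto simp: B_def)
      have "finite A" unfolding A using B fibre by blast
      have "card A \<le> (\<Sum>b\<in>B. card (verts X \<inter> f -` {b}))" unfolding A by (rule card_UN_le[OF B(2)])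
      also have "\<dots> \<le> (\<Sum>b\<in>B. k)" using B fibre by (intro sum_mono) blast
      also have "\<dots> \<le> N * k" using B by simp
      finally have cA: "card A \<le> N * k" .
      have EX: "E \<subseteq> edges X" by (auto simp: E_def induced_def)
      have "E \<subseteq> A \<times> A" using X by (auto simp: E_def A_def induced_def connected_graph_def)
      then have E: "finite E" "card E \<le> N * k * (N * k)"
        using \<open>finite A\<close> cA card_mono[of "A \<times> A" E] mult_le_mono[OF cA cA]
        by (auto simp: card_cartesian_product finite_subset)
      have "sym E" using X by (auto simp: E_def induced_def connected_graph_def sym_def)
      obtain z where z: "(z, x) \<in> E\<^sup>*" "(z, x') \<in> E\<^sup>*"
        using C x unfolding components_of_graph_def B_def[symmetric] E_def[symmetric]
        by (auto elim!: quotientE)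
      then have "(x, x') \<in> E\<^sup>*" using sym_rtrancl[OF \<open>sym E\<close>] by (meson rtrancl_trans symD)
      \<comment> \<open>In a finite relation, reachable points are joined by a walk no longer than
        the number of pairs. The bound is crude, but it does not depend on \<open>y\<close>.\<close>
      then obtain n where "n \<le> card E" "(x, x') \<in> E ^^ n"
        unfolding rtrancl_finite_eq_relpow[OF E(1)] by auto
      then have "(x, x') \<in> edges X ^^ n" "n \<le> N * k * (N * k)"
        using relpow_mono[OF EX] E(2) by auto
      then show ?thesis using graph_dist_le by (meson of_nat_mono order_trans)
    qed
    then show ?thesis by (intro exI[of _ "real (N * k * (N * k))"]) simp
  qed
  moreover have "Lipschitz_continuous_map (graph_metric X) (graph_metric Y) f"
    unfolding Lipschitz_continuous_map_def
    using \<kappa>(1) Lip by (intro conjI exI[of _ "2 * \<bar>\<kappa>\<bar>"]) simp_all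
  ultimately show ?thesis unfolding semi_regular_map_def by blast
qed


section \<open>Cayley graphs\<close>

context group
begin

lemma verts_cayley_graph: "verts (cayley_graph G S) = carrier G"
  by (simp add: cayley_graph_def)

text \<open>Edges come from right multiplication by generators, so left translations preserve them
  by associativity.\<close>

lemma cayley_graph_relpow_mult_left:
  assumes S: "S \<subseteq> carrier G" and a: "a \<in> carrier G"
    and xy: "(x, y) \<in> edges (cayley_graph G S) ^^ n"
  shows "(a \<otimes> x, a \<otimes> y) \<in> edges (cayley_graph G S) ^^ n"
  using xy
proof (induction n arbitrary: y)
  case (Suc n)
  then obtain z where z: "(x, z) \<in> edges (cayley_graph G S) ^^ n" "(z, y) \<in> edges (cayley_graph G S)"
    by auto
  have "(a \<otimes> z, a \<otimes> y) \<in> edges (cayley_graph G S)"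
  proof -
    obtain s where s: "s \<in> S" "z \<in> carrier G" "y \<in> carrier G" "z \<noteq> y" "y = z \<otimes> s \<or> z = y \<otimes> s"
      using z(2) by (auto simp: cayley_graph_def)
    have "s \<in> carrier G" using s(1) S by blast
    then have "a \<otimes> y = a \<otimes> z \<otimes> s \<or> a \<otimes> z = a \<otimes> y \<otimes> s"
      using s(2,3,5) a by (metis m_assoc)
    then show ?thesis using s(1-4) a by (auto simp: cayley_graph_def)
  qed
  with Suc.IH[OF z(1)] show ?case by auto
qed simp

lemma graph_dist_mult_left:
  assumes S: "S \<subseteq> carrier G" and a: "a \<in> carrier G" and x: "x \<in> carrier G" and y: "y \<in> carrier G"
  shows "graph_dist (cayley_graph G S) (a \<otimes> x) (a \<otimes> y) = graph_dist (cayley_graph G S) x y"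
proof -
  have "inv a \<otimes> (a \<otimes> x) = x" "inv a \<otimes> (a \<otimes> y) = y"
    using a x y by (simp_all add: m_assoc[symmetric])
  then have "(a \<otimes> x, a \<otimes> y) \<in> edges (cayley_graph G S) ^^ n \<longleftrightarrow> (x, y) \<in> edges (cayley_graph G S) ^^ n" for n
    using cayley_graph_relpow_mult_left[OF S a, of x y n]
      cayley_graph_relpow_mult_left[OF S inv_closed[OF a], of "a \<otimes> x" "a \<otimes> y" n] by auto
  then show ?thesis by (simp add: graph_dist_def)
qed

text \<open>Each vertex has at most two neighbours per generator. The set collects end points of
  walks of length \<open>n\<close>, so it contains the sphere of radius \<open>n\<close>.\<close>

lemma finite_cayley_graph_sphere:
  assumes "finite S" and S: "S \<subseteq> carrier G"
  shows "finite {y. (x, y) \<in> edges (cayley_graph G S) ^^ n}"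
proof (induction n)
  case (Suc n)
  let ?E = "edges (cayley_graph G S)"
  have "{y. (x, y) \<in> ?E ^^ Suc n} \<subseteq>
    (\<Union>z\<in>{z. (x, z) \<in> ?E ^^ n}. (\<lambda>s. z \<otimes> s) ` S \<union> (\<lambda>s. z \<otimes> inv s) ` S)"
  proof
    fix y assume "y \<in> {y. (x, y) \<in> ?E ^^ Suc n}"
    then obtain z where z: "(x, z) \<in> ?E ^^ n" "(z, y) \<in> ?E" by auto
    then obtain s where s: "s \<in> S" "y = z \<otimes> s \<or> z = y \<otimes> s" "y \<in> carrier G"
      by (auto simp: cayley_graph_def)
    have "s \<in> carrier G" using s(1) S by blast
    then have "y = z \<otimes> s \<or> y = z \<otimes> inv s" using s(2,3) inv_solve_right by blast
    with z s show "y \<in> (\<Union>z\<in>{z. (x, z) \<in> ?E ^^ n}. (\<lambda>s. z \<otimes> s) ` S \<union> (\<lambda>s. z \<otimes> inv s) ` S)"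
      by blast
  qed
  then show ?case by (rule finite_subset) (use Suc assms(1) in blast)
qed simp

text \<open>Every ball is a left translate of the ball about the identity, which is finite because
  \<open>S\<close> is.\<close>

lemma cayley_graph_bounded_growth:
  assumes fin: "finite S" and S: "S \<subseteq> carrier G" and gen: "generate G S = carrier G"
  shows "\<exists>N. \<forall>y\<in>verts (cayley_graph G S). finite (mball_of (graph_metric (cayley_graph G S)) y r) \<and>
    card (mball_of (graph_metric (cayley_graph G S)) y r) \<le> N"
proof -
  let ?Y = "cayley_graph G S"
  have conn: "connected_graph ?Y" by (rule connected_cayley_graph[OF S gen])
  note [simp] = mspace_graph_metric[OF conn] mdist_graph_metric[OF conn] verts_cayley_graph
  let ?B = "\<lambda>y. mball_of (graph_metric ?Y) y r"
  have "?B \<one> \<subseteq> (\<Union>n\<le>nat \<lceil>r\<rceil>. {y. (\<one>, y) \<in> edges ?Y ^^ n})"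
  proof
    fix y assume y: "y \<in> ?B \<one>"
    obtain n where n: "graph_dist ?Y \<one> y = real n" "(\<one>, y) \<in> edges ?Y ^^ n"
      using graph_dist_relpow[OF conn, of \<one> y] y by auto
    with y have "n \<le> nat \<lceil>r\<rceil>" by simp linarith
    with n show "y \<in> (\<Union>n\<le>nat \<lceil>r\<rceil>. {y. (\<one>, y) \<in> edges ?Y ^^ n})" by blast
  qed
  then have B1: "finite (?B \<one>)"
    by (rule finite_subset) (use finite_cayley_graph_sphere[OF fin S] in blast)
  have "?B y \<subseteq> (\<lambda>w. y \<otimes> w) ` ?B \<one>" if y: "y \<in> carrier G" for y
  proof
    fix w assume w: "w \<in> ?B y"
    then have wG: "w \<in> carrier G" by simp
    have eq: "y \<otimes> (inv y \<otimes> w) = w" using y wG by (simp add: m_assoc[symmetric])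
    moreover have "inv y \<otimes> w \<in> ?B \<one>"
      using w y wG graph_dist_mult_left[OF S y, of \<one> "inv y \<otimes> w"] by (simp add: eq)
    ultimately show "w \<in> (\<lambda>w. y \<otimes> w) ` ?B \<one>" by (metis image_eqI)
  qed
  then have "finite (?B y) \<and> card (?B y) \<le> card (?B \<one>)" if "y \<in> carrier G" for y
    using that B1 by (meson surj_card_le finite_surj)
  then show ?thesis by auto
qed

end


section \<open>The lamplighter group\<close>

interpretation lamplighter: group lamplighter_group
  by (rule group_lamplighter)

text \<open>Right multiplication of \<open>(h, m)\<close> by \<open>(g, k)\<close> moves the
  position by \<open>k\<close> and switches the lamps in the support of \<open>g\<close> shifted by
  \<open>m\<close>; finitely many generators give a common bound.\<close>

lemma lamplighter_edge_displacement:
  assumes "finite S" "S \<subseteq> carrier lamplighter_group"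
  obtains K :: int where "K \<ge> 0"
    "\<And>x y. (x, y) \<in> edges (cayley_graph lamplighter_group S) \<Longrightarrow>
      \<bar>snd y - snd x\<bar> \<le> K \<and> (\<forall>i. fst x i \<noteq> fst y i \<longrightarrow> \<bar>i - snd x\<bar> \<le> K)"
proof -
  define U where "U = (\<Union>s\<in>S. {\<bar>snd s\<bar>} \<union> abs ` {i. fst s i \<noteq> 0})"
  have "finite {i. fst s i \<noteq> 0}" if "s \<in> S" for s
    using that assms(2) by (cases s) (auto simp: carrier_lamplighter)
  then have "finite U" using assms(1) by (simp add: U_def)
  then have "bdd_above U" by (rule bdd_above_finite)
  then obtain B where B: "\<And>u. u \<in> U \<Longrightarrow> u \<le> B"
    unfolding bdd_above_def by blast
  have right: "\<bar>snd y - snd x\<bar> \<le> B \<and> (\<forall>i. fst x i \<noteq> fst y i \<longrightarrow> \<bar>i - snd x\<bar> \<le> B)"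
    if s: "s \<in> S" and x: "x \<in> carrier lamplighter_group" and y: "y = x \<otimes>\<^bsub>lamplighter_group\<^esub> s" for x y s
  proof -
    obtain h m g k where [simp]: "x = (h, m)" "s = (g, k)" by (meson surj_pair)
    have "\<bar>k\<bar> \<in> U" using s unfolding U_def by force
    then have k: "\<bar>k\<bar> \<le> B" by (rule B)
    have g: "\<bar>i\<bar> \<le> B" if "g i \<noteq> 0" for i
    proof -
      have "\<bar>i\<bar> \<in> U" using s that unfolding U_def by force
      then show ?thesis by (rule B)
    qed
    have "g (i - m) \<noteq> 0" if "h i \<noteq> (h i + g (i - m)) mod 2" for i
    proof
      assume "g (i - m) = 0"
      moreover have "0 \<le> h i" "h i < 2" using x by (simp_all add: carrier_lamplighter)
      ultimately show False using that by simp
    qed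
    with g k show ?thesis by (simp add: y mult_lamplighter)
  qed
  show thesis
  \<comment> \<open>For an edge traversed against its generator, the lamps are located from
    \<open>snd y\<close>, which is itself up to \<open>B\<close> away from \<open>snd x\<close>;
    hence the factor 2. The absolute value is for empty \<open>S\<close>, where \<open>B\<close> is
    arbitrary.\<close>
  proof (rule that[of "2 * \<bar>B\<bar>"])
    fix x y assume "(x, y) \<in> edges (cayley_graph lamplighter_group S)"
    then obtain s where s: "s \<in> S" "x \<in> carrier lamplighter_group" "y \<in> carrier lamplighter_group"
      "y = x \<otimes>\<^bsub>lamplighter_group\<^esub> s \<or> x = y \<otimes>\<^bsub>lamplighter_group\<^esub> s"
      by (auto simp: cayley_graph_def)
    then consider "\<bar>snd y - snd x\<bar> \<le> B \<and> (\<forall>i. fst x i \<noteq> fst y i \<longrightarrow> \<bar>i - snd x\<bar> \<le> B)"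
      | "\<bar>snd x - snd y\<bar> \<le> B \<and> (\<forall>i. fst y i \<noteq> fst x i \<longrightarrow> \<bar>i - snd y\<bar> \<le> B)"
      using right by blast
    then show "\<bar>snd y - snd x\<bar> \<le> 2 * \<bar>B\<bar> \<and> (\<forall>i. fst x i \<noteq> fst y i \<longrightarrow> \<bar>i - snd x\<bar> \<le> 2 * \<bar>B\<bar>)"
    proof cases
      case 1
      moreover have "B \<le> 2 * \<bar>B\<bar>" by simp
      ultimately show ?thesis by (meson order_trans)
    next
      case 2
      have "\<bar>i - snd x\<bar> \<le> 2 * \<bar>B\<bar>" if "fst x i \<noteq> fst y i" for i
      proof -
        have "\<bar>i - snd y\<bar> \<le> B" using 2 that by metis
        with 2 show ?thesis by linarith
      qed
      moreover have "\<bar>snd y - snd x\<bar> \<le> 2 * \<bar>B\<bar>" using 2 by linarith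
      ultimately show ?thesis by blast
    qed
  qed simp
qed

lemma lamplighter_walk_displacement:
  fixes K :: int
  assumes K: "\<And>x y. (x, y) \<in> E \<Longrightarrow>
      \<bar>snd y - snd x\<bar> \<le> K \<and> (\<forall>i. fst x i \<noteq> fst y i \<longrightarrow> \<bar>i - snd x\<bar> \<le> K)"
    and "K \<ge> 0" and xy: "(x, y) \<in> E ^^ n"
  shows "\<bar>snd y - snd x\<bar> \<le> int n * K \<and> (\<forall>i. fst x i \<noteq> fst y i \<longrightarrow> \<bar>i - snd x\<bar> \<le> int n * K)"
  using xy
proof (induction n arbitrary: y)
  case (Suc n)
  then obtain z where z: "(x, z) \<in> E ^^ n" "(z, y) \<in> E" by auto
  note 1 = Suc.IH[OF z(1)] and 2 = K[OF z(2)]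
  have e: "int (Suc n) * K = int n * K + K" by (simp add: algebra_simps)
  have "\<bar>i - snd x\<bar> \<le> int n * K + K" if "fst x i \<noteq> fst y i" for i
  proof (cases "fst x i = fst z i")
    case True
    with 2 that have "\<bar>i - snd z\<bar> \<le> K" by metis
    with 1 show ?thesis by linarith
  next
    case False
    with 1 have "\<bar>i - snd x\<bar> \<le> int n * K" by metis
    with \<open>K \<ge> 0\<close> show ?thesis by linarith
  qed
  moreover have "\<bar>snd y - snd x\<bar> \<le> int n * K + K" using 1 2 by linarith
  ultimately show ?case unfolding e by blast
qed simp

text \<open>By left invariance, the distance is that from the identity to the quotient of
  \<open>x\<close> and \<open>y\<close>, which ranges over the finite set \<open>W\<close>.\<close>

lemma lamplighter_block_bounded:
  fixes J :: int
  assumes S: "S \<subseteq> carrier lamplighter_group"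
  obtains R where "\<And>x y. x \<in> carrier lamplighter_group \<Longrightarrow> y \<in> carrier lamplighter_group \<Longrightarrow>
    \<bar>snd y - snd x\<bar> \<le> J \<Longrightarrow> (\<And>i. fst x i \<noteq> fst y i \<Longrightarrow> \<bar>i - snd x\<bar> \<le> J) \<Longrightarrow>
    graph_dist (cayley_graph lamplighter_group S) x y \<le> R"
proof -
  let ?L = lamplighter_group and ?Y = "cayley_graph lamplighter_group S"
  define W where "W = {g. \<forall>i. (i \<in> {-J..J} \<longrightarrow> g i \<in> {0..<2}) \<and> (i \<notin> {-J..J} \<longrightarrow> g i = (0::int))} \<times> {-J..J}"
  have "finite W"
    unfolding W_def by (intro finite_cartesian_product finite_set_of_finite_funs) auto
  then have "bdd_above (graph_dist ?Y \<one>\<^bsub>?L\<^esub> ` W)" by simp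
  then obtain R where R: "\<And>w. w \<in> W \<Longrightarrow> graph_dist ?Y \<one>\<^bsub>?L\<^esub> w \<le> R"
    unfolding bdd_above_def by blast
  show thesis
  proof (rule that)
    fix x y assume x: "x \<in> carrier ?L" and y: "y \<in> carrier ?L" and J: "\<bar>snd y - snd x\<bar> \<le> J"
      "\<And>i. fst x i \<noteq> fst y i \<Longrightarrow> \<bar>i - snd x\<bar> \<le> J"
    obtain h m h' m' where xy: "x = (h, m)" "y = (h', m')" by (meson surj_pair)
    \<comment> \<open>This is the inverse of \<open>x\<close> times \<open>y\<close>; modulo 2, the
      sum of lamp states is their difference.\<close>
    define w where "w = (\<lambda>i. (h (i + m) + h' (i + m)) mod 2, m' - m)"
    have h: "h i \<in> {0..<2}" "h' i \<in> {0..<2}" for i using x y by (auto simp: xy carrier_lamplighter)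
    have w0: "(h (i + m) + h' (i + m)) mod 2 = 0" if "i \<notin> {-J..J}" for i
    proof -
      have "\<not> \<bar>i\<bar> \<le> J" using that by auto
      then have "h (i + m) = h' (i + m)" using J(2)[of "i + m"] by (auto simp: xy)
      then show ?thesis by simp
    qed
    have "w \<in> W"
      unfolding W_def w_def
    proof (intro SigmaI CollectI allI conjI impI)
      show "m' - m \<in> {-J..J}" using J(1) by (simp add: xy abs_le_iff)
    qed (simp_all add: w0)
    have "fst w i = 0" if "i \<notin> {-J..J}" for i
      unfolding w_def fst_conv by (rule w0[OF that])
    then have "{i. fst w i \<noteq> 0} \<subseteq> {-J..J}" by blast
    then have "finite {i. fst w i \<noteq> 0}" by (rule finite_subset) simp
    then have wc: "w \<in> carrier ?L" by (simp add: carrier_lamplighter w_def)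
    have "(h i + (h i + h' i) mod 2) mod 2 = h' i" for i
    proof -
      have "h i = 0 \<or> h i = 1" "h' i = 0 \<or> h' i = 1" using h[of i] by auto
      then show ?thesis by auto
    qed
    then have "x \<otimes>\<^bsub>?L\<^esub> w = y" by (simp add: xy w_def mult_lamplighter)
    then have "graph_dist ?Y x y = graph_dist ?Y (x \<otimes>\<^bsub>?L\<^esub> \<one>\<^bsub>?L\<^esub>) (x \<otimes>\<^bsub>?L\<^esub> w)"
      using x by simp
    also have "\<dots> = graph_dist ?Y \<one>\<^bsub>?L\<^esub> w"
      using lamplighter.graph_dist_mult_left[OF S x _ wc] by simp
    finally show "graph_dist ?Y x y \<le> R" using R[OF \<open>w \<in> W\<close>] by simp
  qed
qed

text \<open>Numbers less than \<open>M\<close> apart lie in the same block or in adjacent ones, and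
  adjacent blocks have opposite parity.\<close>

lemma div_eq_if_same_parity:
  fixes a b M :: int
  assumes "\<bar>a - b\<bar> < M" "even (a div M) = even (b div M)"
  shows "a div M = b div M"
proof -
  have "M > 0" using assms(1) by linarith
  have "a div M \<le> (b + M) div M" "b div M \<le> (a + M) div M"
    by (rule zdiv_mono1; use assms(1) \<open>M > 0\<close> in linarith)+
  moreover have "(a + M) div M = a div M + 1" "(b + M) div M = b div M + 1"
    using \<open>M > 0\<close> by simp_all
  ultimately have "a div M \<le> b div M + 1" "b div M \<le> a div M + 1" by linarith+
  then consider "a div M = b div M" | "a div M = b div M + 1" | "b div M = a div M + 1"
    by linarith
  then show ?thesis using assms(2) by cases auto
qed

lemma abs_diff_less_if_div_eq:
  fixes a b M :: int
  assumes "M > 0" "a div M = b div M"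
  shows "\<bar>a - b\<bar> < M"
proof -
  have "a - b = a mod M - b mod M" using assms(2) by (simp add: minus_mult_div_eq_mod[symmetric])
  then show ?thesis using pos_mod_bound[OF assms(1), of a] pos_mod_bound[OF assms(1), of b]
      pos_mod_sign[OF assms(1), of a] pos_mod_sign[OF assms(1), of b] by linarith
qed

lemma no_semi_regular_map_lamplighter:
  assumes fin: "finite S" and S: "S \<subseteq> carrier lamplighter_group"
    and gen: "generate lamplighter_group S = carrier lamplighter_group"
  shows "\<not> semi_regular_map square_lattice (cayley_graph lamplighter_group S) f"
proof
  let ?X = square_lattice and ?Y = "cayley_graph lamplighter_group S"
  assume f: "semi_regular_map ?X ?Y f"
  have Y: "connected_graph ?Y" by (rule lamplighter.connected_cayley_graph[OF S gen])
  interpret Y: Metric_space "verts ?Y" "graph_dist ?Y" by (rule Metric_space_graph_dist[OF Y])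
  obtain L where L: "L \<ge> 0" "f \<in> UNIV \<rightarrow> verts ?Y"
    "\<And>z w. graph_dist ?Y (f z) (f w) \<le> L * graph_dist ?X z w"
    using semi_regular_map_Lipschitz[OF connected_square_lattice Y f] by auto
  have fY: "f z \<in> verts ?Y" for z using L(2) by auto
  then have fc: "f z \<in> carrier lamplighter_group" for z by (simp add: lamplighter.verts_cayley_graph)
  obtain K :: int where K: "K \<ge> 0" "\<And>x y. (x, y) \<in> edges ?Y \<Longrightarrow>
      \<bar>snd y - snd x\<bar> \<le> K \<and> (\<forall>i. fst x i \<noteq> fst y i \<longrightarrow> \<bar>i - snd x\<bar> \<le> K)"
    using lamplighter_edge_displacement[OF fin S] by metis
  \<comment> \<open>A king move is at most two lattice edges, hence at most \<open>N\<close> edges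
    in the image. \<open>J\<close> bounds both the change of position and the distance of switched
    lamps in such a move.\<close>
  define N where "N = nat \<lceil>2 * L\<rceil>"
  define J where "J = int N * K"
  have J0: "J \<ge> 0" using K(1) by (simp add: J_def)
  have jump: "\<bar>snd (f w) - snd (f z)\<bar> \<le> J \<and> (\<forall>i. fst (f z) i \<noteq> fst (f w) i \<longrightarrow> \<bar>i - snd (f z)\<bar> \<le> J)"
    if zw: "king_adj z w" for z w
  proof -
    obtain m where m: "z = m \<or> (z, m) \<in> edges ?X" "m = w \<or> (m, w) \<in> edges ?X"
      using king_adj_midpoint[OF zw] .
    have "graph_dist ?Y (f z) (f m) \<le> L" "graph_dist ?Y (f m) (f w) \<le> L"
      using L(3)[of z m] L(3)[of m w] mult_left_mono[OF graph_dist_edge_le[OF m(1)] L(1)]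
        mult_left_mono[OF graph_dist_edge_le[OF m(2)] L(1)] by auto
    then have d: "graph_dist ?Y (f z) (f w) \<le> 2 * L"
      using Y.triangle[OF fY[of z] fY[of m] fY[of w]] by linarith
    obtain n where n: "graph_dist ?Y (f z) (f w) = real n" "(f z, f w) \<in> edges ?Y ^^ n"
      using graph_dist_relpow[OF Y fY fY] .
    have "n \<le> N" using d n(1) unfolding N_def by linarith
    then have "int n * K \<le> J" unfolding J_def using K(1) by (intro mult_right_mono) auto
    with lamplighter_walk_displacement[OF K(2) K(1) n(2)] show ?thesis by force
  qed
  \<comment> \<open>With this length a jump reaches at most an adjacent block, and positions in one
    block differ by at most \<open>J\<close>.\<close>
  define M where "M = J + 1"
  define col where "col z = even (snd (f z) div M)" for z
  \<comment> \<open>The bound on lamps does not accumulate along the path: the position never leaves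
    the block, so it stays within \<open>J\<close> of \<open>snd (f z)\<close>, and each move
    switches only lamps within \<open>J\<close> of the position.\<close>
  have block: "snd (f w) div M = snd (f z) div M \<and>
      (\<forall>i. fst (f z) i \<noteq> fst (f w) i \<longrightarrow> \<bar>i - snd (f z)\<bar> \<le> 2 * J)"
    if "(z, w) \<in> clusters col" for z w
    using that unfolding clusters_def
  proof (induction rule: rtrancl_induct)
    case (step y w)
    then have yw: "king_adj y w" "col y = col w" by auto
    note J = jump[OF yw(1)]
    have div: "snd (f w) div M = snd (f y) div M"
      using div_eq_if_same_parity[of "snd (f w)" "snd (f y)" M] J yw(2) by (simp add: col_def M_def)
    have near: "\<bar>snd (f y) - snd (f z)\<bar> \<le> J"
      using abs_diff_less_if_div_eq[of M "snd (f y)" "snd (f z)"] step.IH J0 by (simp add: M_def)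
    have "\<bar>i - snd (f z)\<bar> \<le> 2 * J" if "fst (f z) i \<noteq> fst (f w) i" for i
    proof (cases "fst (f z) i = fst (f y) i")
      case True
      with J that have "\<bar>i - snd (f y)\<bar> \<le> J" by metis
      with near show ?thesis by linarith
    next
      case False
      with step.IH show ?thesis by blast
    qed
    with div step.IH show ?case by simp
  qed (use J0 in auto)
  obtain R where R: "\<And>x y. x \<in> carrier lamplighter_group \<Longrightarrow> y \<in> carrier lamplighter_group \<Longrightarrow>
    \<bar>snd y - snd x\<bar> \<le> 2 * J \<Longrightarrow> (\<And>i. fst x i \<noteq> fst y i \<Longrightarrow> \<bar>i - snd x\<bar> \<le> 2 * J) \<Longrightarrow>
    graph_dist ?Y x y \<le> R"
    using lamplighter_block_bounded[OF S, of "2 * J"] by blast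
  show False
  proof (rule no_semi_regular_map_square_lattice[OF Y f])
    fix z w assume zw: "(z, w) \<in> clusters col"
    show "graph_dist ?Y (f z) (f w) \<le> R"
    proof (rule R[OF fc fc])
      show "\<bar>snd (f w) - snd (f z)\<bar> \<le> 2 * J"
        using abs_diff_less_if_div_eq[of M "snd (f w)" "snd (f z)"] block[OF zw] J0 by (simp add: M_def)
      show "\<bar>i - snd (f z)\<bar> \<le> 2 * J" if "fst (f z) i \<noteq> fst (f w) i" for i
        using block[OF zw] that by blast
    qed
  qed
qed

theorem mainTheorem7:
  fixes S :: "((int \<Rightarrow> int) \<times> int) set"
  assumes "finite S"
    and "S \<subseteq> carrier lamplighter_group"
    and "generate lamplighter_group S = carrier lamplighter_group"
  shows "(\<nexists>f. semi_regular_map square_lattice (cayley_graph lamplighter_group S) f) \<and>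
         (\<nexists>f. regular_map (graph_metric square_lattice)
                (graph_metric (cayley_graph lamplighter_group S)) f)"
proof -
  \<comment> \<open>A regular map would be semi-regular, by the bounded growth of the Cayley
    graph.\<close>
  have "\<not> regular_map (graph_metric square_lattice) (graph_metric (cayley_graph lamplighter_group S)) f" for f
    using regular_map_imp_semi_regular_map[OF connected_square_lattice
        lamplighter.connected_cayley_graph[OF assms(2,3)]
        lamplighter.cayley_graph_bounded_growth[OF assms]]
      no_semi_regular_map_lamplighter[OF assms] by blast
  then show ?thesis using no_semi_regular_map_lamplighter[OF assms] by blast
qed

end
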